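(* Let $r,N$ be integers with $N>r>0$ and let $A=\{A(i,j)\}_{i,j=1}^N$ be an invertible lower band matrix of order $r$. Let $0<\mu<1$ and assume that $A$ satisfies the strong dominance condition $$\mu|A(k,k)|\ \geq\ \sum_{i=1}^{k-1}|A(i,k)|+\sum_{i=k+1}^{k+r}|A(i,k)|,\qquad k=1,2,\dots,N .$$ Then the blocks $(A^{-1})'(i,j)$ of the Green block partition of $A^{-1}$ satisfy $$|(A^{-1})'(i,j)|\le M\gamma^{\,i-j-r}\qquad\text{whenever } i-j>r,$$ where $\gamma=\mu^{1/r}$ and $$M=\frac{1+\mu^2}{(1-\mu)(1-\mu^2)\min_{1\le i\le N}|A(i,i)|}.$$ Here the bound on a block means that every scalar entry of the block is bounded in absolute value by the right-hand side.
   Context: Matrices have scalar (real or complex) entries. A matrix $A=\{A(i,j)\}_{i,j=1}^N$ is a lower band matrix of order $r$ if $A(i,j)=0$ for $i-j>r$ (no band condition is imposed on the upper triangular part). Entries $A(i,k)$ with row index $i>N$ are understood to be absent (zero) in sums. Green block partition: an $N\times N$ matrix $B$ is viewed as a block matrix $\{B'(i,j)\}_{i,j=0}^{N-r+1}$, the block $B'(i,j)$ having size $m_i\times n_j$, with $m_0=0$, $m_1=\dots=m_{N-r}=1$, $m_{N-r+1}=r$ and $n_0=r$, $n_1=\dots=n_{N-r}=1$, $n_{N-r+1}=0$. Thus block row $i$ for $1\le i\le N-r$ is the scalar row $i$; block row $N-r+1$ consists of the scalar rows $N-r+1,\dots,N$; block column $0$ consists of the scalar columns $1,\dots,r$; and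 block column $j$ for $1\le j\le N-r$ is the scalar column $r+j$. Block row $0$ and block column $N-r+1$ are empty. The prime in $B'(i,j)$ distinguishes blocks of this partition from scalar entries $B(i,j)$. *)

theory Defs
  imports Complex_Main "Jordan_Normal_Form.Matrix"
begin

(* Matrices are Jordan_Normal_Form matrices, whose indices start at 0; "entry" gives the
   scalar entry A(i,j) with indices starting at 1, and is 0 at positions outside the matrix. *)
definition entry :: "'a::zero mat \<Rightarrow> nat \<Rightarrow> nat \<Rightarrow> 'a" where
  "entry A i j =
     (if i \<in> {1..dim_row A} \<and> j \<in> {1..dim_col A} then A $$ (i - 1, j - 1) else 0)"

definition lower_band :: "nat \<Rightarrow> 'a::zero mat \<Rightarrow> bool" where
  "lower_band r A \<longleftrightarrow>
     (\<forall>i\<in>{1..dim_row A}. \<forall>j\<in>{1..dim_col A}. i > j + r \<longrightarrow> entry A i j = 0)"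

definition green_row_size :: "nat \<Rightarrow> nat \<Rightarrow> nat \<Rightarrow> nat" where
  "green_row_size N r i = (if i = 0 then 0 else if i \<le> N - r then 1 else r)"

definition green_col_size :: "nat \<Rightarrow> nat \<Rightarrow> nat \<Rightarrow> nat" where
  "green_col_size N r j = (if j = 0 then r else if j \<le> N - r then 1 else 0)"

(* For block indices i, j in {0..N - r + 1}: the block B'(i,j). The sums count the scalar
   rows above the block and the scalar columns to the left of it. *)
definition green_block :: "nat \<Rightarrow> nat \<Rightarrow> 'a mat \<Rightarrow> nat \<Rightarrow> nat \<Rightarrow> 'a mat" where
  "green_block N r B i j =
     mat (green_row_size N r i) (green_col_size N r j)
       (\<lambda>(p, q). B $$ ((\<Sum>k<i. green_row_size N r k) + p, (\<Sum>k<j. green_col_size N r k) + q))"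

end

theory Submission
  imports Defs
begin

text \<open>
  Fix a column \<open>c\<close> of \<open>A\<^sup>-\<^sup>1\<close>, call it \<open>x\<close>, and weight its entries by the diagonal of \<open>A\<close>:
  \<open>w k = norm (A\<^sub>k\<^sub>k x\<^sub>k)\<close>.  Everything follows from the tail sums \<open>S t = (\<Sum>k\<ge>t. w k)\<close>.
  Solving row \<open>i\<close> of \<open>A x = e\<^sub>c\<close> for its diagonal term and adding up the rows \<open>i \<ge> t\<close>
  gives, after exchanging the two sums, column sums of off-diagonal entries of \<open>A\<close>.  The
  dominance condition turns column \<open>k\<close> into at most \<open>\<mu> w k\<close>, and the band
  condition removes every column \<open>k\<close> with \<open>k + r < t\<close>.  Hence
  \<open>S t \<le> [t \<le> c] + \<mu> S (t - r)\<close> (lemma \<open>tail_sum_contraction\<close>).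

  Taking \<open>t = 0\<close> yields \<open>S 0 \<le> 1 / (1 - \<mu>)\<close>, a bound for all tails.  Below the position
  of the unit entry each step of length \<open>r\<close> costs a factor \<open>\<mu> = \<gamma>\<^sup>r\<close>, so
  \<open>S (c + d) \<le> \<gamma>\<^sup>d / (1 - \<mu>)\<close>.  Dividing by the diagonal entry gives the scalar estimate
  \<open>norm (A\<^sup>-\<^sup>1(R, c)) \<le> \<gamma>\<^bsup>R - c\<^esup> / ((1 - \<mu>) norm A\<^sub>R\<^sub>R)\<close> on and below the diagonal
  (lemma \<open>inverse_entry_decay\<close>).

  In the Green partition the rows of block row \<open>i\<close> lie at or below scalar row \<open>i\<close>, and the
  columns of block column \<open>j\<close> at or to the left of scalar column \<open>r + j\<close>, so an entry of block
  \<open>(i, j)\<close> has distance at least \<open>i - j - r\<close> from the diagonal.  The constant \<open>M\<close> is the one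
  obtained here times the factor \<open>(1 + \<mu>\<^sup>2) / (1 - \<mu>\<^sup>2) \<ge> 1\<close>.
\<close>

section \<open>Decay below the diagonal of the inverse\<close>

lemma tail_sum_contraction:
  fixes a :: "nat \<Rightarrow> nat \<Rightarrow> 'a::real_normed_field" and x b :: "nat \<Rightarrow> 'a"
  assumes dominant: "\<And>k. k < N \<Longrightarrow> (\<Sum>l\<in>{..<N} - {k}. norm (a l k)) \<le> \<mu> * norm (a k k)"
    and band: "\<And>l k. l < N \<Longrightarrow> k + r < l \<Longrightarrow> a l k = 0"
    and solves: "\<And>l. l < N \<Longrightarrow> (\<Sum>k<N. a l k * x k) = b l"
  \<comment> \<open>Truncated subtraction in \<open>t - r\<close> is harmless: for \<open>t \<le> r\<close> the tail is the full sum.\<close>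
  shows "(\<Sum>l\<in>{t..<N}. norm (a l l * x l))
    \<le> (\<Sum>l\<in>{t..<N}. norm (b l)) + \<mu> * (\<Sum>k\<in>{t - r..<N}. norm (a k k * x k))"
proof -
  have row: "norm (a l l * x l) \<le> norm (b l) + (\<Sum>k<N. if k = l then 0 else norm (a l k) * norm (x k))"
    if "l < N" for l
  proof -
    have "(\<Sum>k<N. a l k * x k) = a l l * x l + (\<Sum>k\<in>{..<N} - {l}. a l k * x k)"
      using that by (subst sum.remove[of _ l]) auto
    hence "a l l * x l = b l - (\<Sum>k\<in>{..<N} - {l}. a l k * x k)"
      using solves[OF that] by (simp add: algebra_simps)
    hence "norm (a l l * x l) \<le> norm (b l) + norm (\<Sum>k\<in>{..<N} - {l}. a l k * x k)"
      by (simp only: norm_triangle_ineq4)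
    also have "norm (\<Sum>k\<in>{..<N} - {l}. a l k * x k) \<le> (\<Sum>k\<in>{..<N} - {l}. norm (a l k) * norm (x k))"
      by (rule order_trans[OF norm_sum]) (simp add: norm_mult)
    also have "\<dots> = (\<Sum>k<N. if k = l then 0 else norm (a l k) * norm (x k))"
      by (rule sum.mono_neutral_cong_left) auto
    finally show ?thesis by simp
  qed
  have column: "(\<Sum>l\<in>{t..<N}. if k = l then 0 else norm (a l k) * norm (x k))
      \<le> (if t - r \<le> k then \<mu> * norm (a k k * x k) else 0)" if "k < N" for k
  proof (cases "t - r \<le> k")
    case True
    have "(\<Sum>l\<in>{t..<N}. if k = l then 0 else norm (a l k) * norm (x k))
        = (\<Sum>l\<in>{t..<N} - {k}. norm (a l k) * norm (x k))"
      by (rule sum.mono_neutral_cong_right) auto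
    also have "\<dots> \<le> (\<Sum>l\<in>{..<N} - {k}. norm (a l k) * norm (x k))"
      by (rule sum_mono2) auto
    also have "\<dots> = (\<Sum>l\<in>{..<N} - {k}. norm (a l k)) * norm (x k)"
      by (simp add: sum_distrib_right)
    also have "\<dots> \<le> \<mu> * norm (a k k) * norm (x k)"
      by (rule mult_right_mono[OF dominant[OF that]]) simp
    finally show ?thesis using True by (simp add: norm_mult mult.assoc)
  next
    case False
    hence "(\<Sum>l\<in>{t..<N}. if k = l then 0 else norm (a l k) * norm (x k)) = 0"
      by (intro sum.neutral) (auto simp: band)
    then show ?thesis using False by simp
  qed
  have "(\<Sum>l\<in>{t..<N}. norm (a l l * x l))
      \<le> (\<Sum>l\<in>{t..<N}. norm (b l) + (\<Sum>k<N. if k = l then 0 else norm (a l k) * norm (x k)))"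
    by (rule sum_mono) (use row in auto)
  also have "\<dots> = (\<Sum>l\<in>{t..<N}. norm (b l))
      + (\<Sum>k<N. \<Sum>l\<in>{t..<N}. if k = l then 0 else norm (a l k) * norm (x k))"
    by (simp only: sum.distrib) (subst sum.swap, rule refl)
  also have "(\<Sum>k<N. \<Sum>l\<in>{t..<N}. if k = l then 0 else norm (a l k) * norm (x k))
      \<le> (\<Sum>k<N. if t - r \<le> k then \<mu> * norm (a k k * x k) else 0)"
    by (rule sum_mono) (use column in auto)
  also have "\<dots> = (\<Sum>k\<in>{t - r..<N}. \<mu> * norm (a k k * x k))"
    by (rule sum.mono_neutral_cong_right) auto
  finally show ?thesis by (simp add: sum_distrib_left)
qed

text \<open>
  Steps of length \<open>r\<close>, each gaining the factor \<open>\<gamma>\<^sup>r\<close>, lead from \<open>c + d\<close> back to a place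
  at or before \<open>c\<close>, where the uniform bound applies; a last step that overshoots \<open>c\<close> has gained
  more than is needed, because \<open>\<gamma> \<le> 1\<close>.
\<close>
lemma geometric_decay_of_step_contraction:
  fixes S :: "nat \<Rightarrow> real" and C \<gamma> :: real
  assumes "0 < r" "0 \<le> \<gamma>" "\<gamma> \<le> 1" "0 \<le> C"
    and bounded: "\<And>t. S t \<le> C"
    and step: "\<And>t. c < t \<Longrightarrow> S t \<le> \<gamma> ^ r * S (t - r)"
  shows "S (c + d) \<le> C * \<gamma> ^ d"
proof (induction d rule: less_induct)
  case (less d)
  show ?case
  proof (cases "d = 0")
    case True
    then show ?thesis using bounded by simp
  next
    case False
    hence contract: "S (c + d) \<le> \<gamma> ^ r * S (c + d - r)" using step by simp
    show ?thesis
    proof (cases "r \<le> d")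
      case True
      have "S (c + (d - r)) \<le> C * \<gamma> ^ (d - r)" using less.IH[of "d - r"] False assms(1) by simp
      hence "\<gamma> ^ r * S (c + d - r) \<le> \<gamma> ^ r * (C * \<gamma> ^ (d - r))"
        using True assms(2) by (intro mult_left_mono) simp_all
      also have "\<dots> = C * \<gamma> ^ d"
        using True by (simp add: power_add[symmetric])
      finally show ?thesis using contract by simp
    next
      case False
      have "\<gamma> ^ r * S (c + d - r) \<le> \<gamma> ^ r * C"
        using bounded assms(2) by (intro mult_left_mono) simp_all
      also have "\<dots> \<le> \<gamma> ^ d * C"
        using False assms by (intro mult_right_mono power_decreasing) simp_all
      finally show ?thesis using contract by (simp add: mult.commute)
    qed
  qed
qed

lemma inverse_entry_decay:
  fixes A B :: "'a::real_normed_field mat" and \<mu> \<gamma> :: real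
  assumes A: "A \<in> carrier_mat N N" and B: "B \<in> carrier_mat N N" and inverse: "A * B = 1\<^sub>m N"
    and "0 < r" and \<mu>: "0 \<le> \<mu>" "\<mu> < 1" and \<gamma>: "0 \<le> \<gamma>" "\<gamma> \<le> 1" "\<gamma> ^ r = \<mu>"
    and dominant: "\<And>k. k < N \<Longrightarrow> (\<Sum>l\<in>{..<N} - {k}. norm (A $$ (l, k))) \<le> \<mu> * norm (A $$ (k, k))"
    and band: "\<And>l k. l < N \<Longrightarrow> k + r < l \<Longrightarrow> A $$ (l, k) = 0"
    and "c \<le> R" "R < N"
  shows "norm (A $$ (R, R) * B $$ (R, c)) \<le> \<gamma> ^ (R - c) / (1 - \<mu>)"
proof -
  define S where "S t = (\<Sum>l\<in>{t..<N}. norm (A $$ (l, l) * B $$ (l, c)))" for t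
  have c: "c < N" using assms by simp
  have "(\<Sum>k<N. A $$ (l, k) * B $$ (k, c)) = (if l = c then 1 else 0)" if "l < N" for l
  proof -
    have "(A * B) $$ (l, c) = (\<Sum>k<N. A $$ (l, k) * B $$ (k, c))"
      using A B c that by (simp add: scalar_prod_def lessThan_atLeast0)
    thus ?thesis using inverse c that by simp
  qed
  note contraction = tail_sum_contraction[of N "\<lambda>l k. A $$ (l, k)" \<mu> r, OF dominant band this]
  have unit: "(\<Sum>l\<in>{t..<N}. norm (if l = c then 1 else 0 :: 'a)) = (if t \<le> c then 1 else 0)" for t
    using c by (simp add: if_distrib[of norm] cong: if_cong)
  \<comment> \<open>At \<open>t = 0\<close> the same inequality bounds the full sum in terms of itself.\<close>
  have S_step: "S t \<le> (if t \<le> c then 1 else 0) + \<mu> * S (t - r)" for t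
    using contraction[of t] unfolding S_def unit by simp
  have "S 0 \<le> 1 / (1 - \<mu>)"
    using S_step[of 0] \<mu> by (simp add: field_simps)
  moreover have "S t \<le> S 0" for t
    unfolding S_def by (rule sum_mono2) auto
  ultimately have "S t \<le> 1 / (1 - \<mu>)" for t
    using order_trans by blast
  moreover have "S t \<le> \<gamma> ^ r * S (t - r)" if "c < t" for t
    using S_step[of t] that \<gamma>(3) by simp
  ultimately have "S (c + (R - c)) \<le> 1 / (1 - \<mu>) * \<gamma> ^ (R - c)"
    using \<open>0 < r\<close> \<gamma>(1,2) \<mu> by (intro geometric_decay_of_step_contraction[of r]) auto
  moreover have "norm (A $$ (R, R) * B $$ (R, c)) \<le> S R"
    unfolding S_def by (rule member_le_sum) (use \<open>R < N\<close> in auto)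
  ultimately show ?thesis using \<open>c \<le> R\<close> by simp
qed

text \<open>
  A vanishing diagonal entry would force its whole column to vanish, which no left inverse can
  map to a unit vector.
\<close>
lemma column_dominant_diagonal_nonzero:
  fixes A B :: "'a::real_normed_field mat"
  assumes A: "A \<in> carrier_mat N N" and B: "B \<in> carrier_mat N N" and inverse: "B * A = 1\<^sub>m N"
    and dominant: "(\<Sum>l\<in>{..<N} - {k}. norm (A $$ (l, k))) \<le> \<mu> * norm (A $$ (k, k))"
    and "k < N"
  shows "A $$ (k, k) \<noteq> 0"
proof
  assume zero: "A $$ (k, k) = 0"
  have "(\<Sum>l\<in>{..<N} - {k}. norm (A $$ (l, k))) = 0"
    using dominant zero by (intro antisym sum_nonneg) auto
  hence "A $$ (l, k) = 0" if "l < N" for l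
    using that zero by (cases "l = k") (auto simp: sum_nonneg_eq_0_iff)
  hence "(B * A) $$ (k, k) = 0"
    using A B \<open>k < N\<close> by (simp add: scalar_prod_def)
  thus False using inverse \<open>k < N\<close> by simp
qed

section \<open>Position of the Green blocks\<close>

lemma sum_green_row_size:
  assumes "0 < i" "i \<le> N - r + 1"
  shows "(\<Sum>k<i. green_row_size N r k) = i - 1"
  using assms
proof (induction i)
  case (Suc i)
  then show ?case by (cases i) (auto simp: green_row_size_def)
qed simp

lemma sum_green_col_size:
  assumes "j \<le> N - r + 1"
  shows "(\<Sum>k<j. green_col_size N r k) = (if j = 0 then 0 else r + j - 1)"
  using assms
proof (induction j)
  case (Suc j)
  then show ?case by (cases j) (auto simp: green_col_size_def)
qed simp

text \<open>
  Here \<open>R\<close> and \<open>c\<close> count from \<open>0\<close>, so together they give \<open>R - c \<ge> i - j - r\<close>.  The bound on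
  \<open>c\<close> is attained by the single column of a block column \<open>j > 0\<close> and by the last of the \<open>r\<close>
  columns of block column \<open>0\<close>.
\<close>
lemma green_block_elements:
  assumes "x \<in> elements_mat (green_block N r B i j)" and "r \<le> N" and "i \<le> N - r + 1" and "j < i"
  obtains R c where "x = B $$ (R, c)" "R < N" "i \<le> R + 1" "c < r + j"
proof -
  from assms(1) obtain p q where
    p: "p < green_row_size N r i" and q: "q < green_col_size N r j" and
    x: "x = B $$ ((\<Sum>k<i. green_row_size N r k) + p, (\<Sum>k<j. green_col_size N r k) + q)"
    unfolding elements_mat_def green_block_def by auto
  show ?thesis
  proof (rule that[OF x])
    show "(\<Sum>k<i. green_row_size N r k) + p < N" "i \<le> (\<Sum>k<i. green_row_size N r k) + p + 1"
      using p assms sum_green_row_size[of i N r]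
      by (auto simp: green_row_size_def[of N r i] split: if_splits)
    show "(\<Sum>k<j. green_col_size N r k) + q < r + j"
      using q assms sum_green_col_size[of j N r]
      by (auto simp: green_col_size_def[of N r j] split: if_splits)
  qed
qed

section \<open>Exponential decay of the Green blocks\<close>

theorem theorem3p1:
  fixes A Ainv :: "'a::real_normed_field mat"
    and r N i j :: nat and \<mu> \<gamma> M :: real
  assumes "0 < r" and "r < N"
    and "A \<in> carrier_mat N N" and "invertible_mat A"
    and "inverts_mat A Ainv" and "inverts_mat Ainv A"
    and "lower_band r A"
    and "0 < \<mu>" and "\<mu> < 1"
    and dominance: "\<And>k. k \<in> {1..N} \<Longrightarrow>
      \<mu> * norm (entry A k k) \<ge>
        (\<Sum>l = 1..k - 1. norm (entry A l k)) + (\<Sum>l = k + 1..k + r. norm (entry A l k))"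
    and "\<gamma> = \<mu> powr (1 / real r)"
    and "M = (1 + \<mu>\<^sup>2) / ((1 - \<mu>) * (1 - \<mu>\<^sup>2) * Min ((\<lambda>l. norm (entry A l l)) ` {1..N}))"
    and "i \<le> N - r + 1" and "j \<le> N - r + 1" and "i > j + r"
  shows "\<forall>x \<in> elements_mat (green_block N r Ainv i j). norm x \<le> M * \<gamma> ^ (i - j - r)"
proof
  fix x assume x: "x \<in> elements_mat (green_block N r Ainv i j)"
  note A = \<open>A \<in> carrier_mat N N\<close>
  have right: "A * Ainv = 1\<^sub>m N" and left: "Ainv * A = 1\<^sub>m (dim_row Ainv)"
    using \<open>inverts_mat A Ainv\<close> \<open>inverts_mat Ainv A\<close> A by (auto simp: inverts_mat_def)
  have B: "Ainv \<in> carrier_mat N N"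
  proof
    show "dim_col Ainv = N" using arg_cong[OF right, of dim_col] by simp
    show "dim_row Ainv = N" using arg_cong[OF left, of dim_col] A by simp
  qed
  have entry: "entry A (Suc l) (Suc k) = A $$ (l, k)" if "l < N" "k < N" for l k
    using that A by (simp add: entry_def)
  have band: "A $$ (l, k) = 0" if "l < N" "k + r < l" for l k
    using \<open>lower_band r A\<close> that A entry[of l k] by (auto simp: lower_band_def)
  have dominant: "(\<Sum>l\<in>{..<N} - {k}. norm (A $$ (l, k))) \<le> \<mu> * norm (A $$ (k, k))"
    if "k < N" for k
  proof -
    let ?e = "\<lambda>l. norm (entry A l (Suc k))"
    have "(\<Sum>l\<in>{..<N} - {k}. norm (A $$ (l, k))) = (\<Sum>l\<in>{..<N} - {k}. ?e (Suc l))"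
      using that by (intro sum.cong) (auto simp: entry)
    also have "\<dots> = sum ?e (Suc ` ({..<N} - {k}))"
      by (simp add: sum.reindex)
    \<comment> \<open>The given condition reaches only \<open>r\<close> rows below the diagonal; the rows further down lie outside the band.\<close>
    also have "\<dots> = sum ?e ({1..k} \<union> {k + 2..Suc k + r} \<inter> Suc ` ({..<N} - {k}))"
    proof (rule sum.mono_neutral_right)
      show "{1..k} \<union> {k + 2..Suc k + r} \<inter> Suc ` ({..<N} - {k}) \<subseteq> Suc ` ({..<N} - {k})"
      proof
        fix l assume "l \<in> {1..k} \<union> {k + 2..Suc k + r} \<inter> Suc ` ({..<N} - {k})"
        thus "l \<in> Suc ` ({..<N} - {k})" using that by (cases l) auto
      qed
      show "\<forall>l\<in>Suc ` ({..<N} - {k}) - ({1..k} \<union> {k + 2..Suc k + r} \<inter> Suc ` ({..<N} - {k})). ?e l = 0"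
        using that by (auto simp: entry intro!: band)
    qed simp
    also have "\<dots> \<le> sum ?e ({1..k} \<union> {k + 2..Suc k + r})"
      by (rule sum_mono2) auto
    also have "\<dots> = sum ?e {1..k} + sum ?e {k + 2..Suc k + r}"
      by (rule sum.union_disjoint) auto
    also have "\<dots> \<le> \<mu> * norm (A $$ (k, k))"
      using dominance[of "Suc k"] that by (simp add: entry)
    finally show ?thesis .
  qed
  obtain R c where Rc: "x = Ainv $$ (R, c)" "R < N" "i \<le> R + 1" "c < r + j"
    using green_block_elements[OF x] \<open>r < N\<close> \<open>i \<le> N - r + 1\<close> \<open>i > j + r\<close> by auto
  have \<gamma>: "0 < \<gamma>" "\<gamma> \<le> 1"
    using \<open>\<gamma> = \<mu> powr (1 / real r)\<close> \<open>0 < \<mu>\<close> \<open>\<mu> < 1\<close> by (simp_all add: powr_le1)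
  have \<gamma>_power: "\<gamma> ^ r = \<mu>"
    using \<open>\<gamma> = \<mu> powr (1 / real r)\<close> \<open>0 < \<mu>\<close> \<open>0 < r\<close>
    by (simp add: powr_realpow[symmetric] powr_powr)
  have "norm (A $$ (R, R) * x) \<le> \<gamma> ^ (R - c) / (1 - \<mu>)"
    unfolding Rc(1)
  proof (rule inverse_entry_decay[OF A B right \<open>0 < r\<close> _ \<open>\<mu> < 1\<close> _ \<gamma>(2) \<gamma>_power dominant band])
    show "c \<le> R" using Rc \<open>i > j + r\<close> by simp
  qed (use \<gamma> \<open>0 < \<mu>\<close> \<open>R < N\<close> in simp_all)
  also have "\<dots> \<le> \<gamma> ^ (i - j - r) / (1 - \<mu>)"
    using \<gamma> \<open>\<mu> < 1\<close> Rc by (intro divide_right_mono power_decreasing) auto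
  finally have weighted: "norm (A $$ (R, R)) * norm x \<le> \<gamma> ^ (i - j - r) / (1 - \<mu>)"
    by (simp add: norm_mult)

  define m where "m = Min ((\<lambda>l. norm (entry A l l)) ` {1..N})"
  have diagonal: "0 < norm (entry A l l)" if l: "l \<in> {1..N}" for l
  proof -
    have "l - 1 < N" using l by auto
    thus ?thesis
      using column_dominant_diagonal_nonzero[of A N Ainv "l - 1" \<mu>] A B left dominant[of "l - 1"]
        entry[of "l - 1" "l - 1"] l by simp
  qed
  have "m \<in> (\<lambda>l. norm (entry A l l)) ` {1..N}"
    unfolding m_def using \<open>R < N\<close> by (intro Min_in) auto
  hence m: "0 < m" using diagonal by auto
  have "m \<le> norm (entry A (Suc R) (Suc R))"
    unfolding m_def using \<open>R < N\<close> by (intro Min_le) auto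
  hence "m * norm x \<le> \<gamma> ^ (i - j - r) / (1 - \<mu>)"
    using entry[of R R] \<open>R < N\<close> by (intro order_trans[OF mult_right_mono weighted]) auto
  hence bound: "norm x \<le> 1 / ((1 - \<mu>) * m) * \<gamma> ^ (i - j - r)"
    using m \<open>\<mu> < 1\<close> by (simp add: field_simps)
  have "\<mu>\<^sup>2 < 1"
    using \<open>0 < \<mu>\<close> \<open>\<mu> < 1\<close> by (simp add: power_less_one_iff)
  hence "1 \<le> (1 + \<mu>\<^sup>2) / (1 - \<mu>\<^sup>2)"
    by (simp add: field_simps)
  hence "1 / ((1 - \<mu>) * m) * 1 \<le> 1 / ((1 - \<mu>) * m) * ((1 + \<mu>\<^sup>2) / (1 - \<mu>\<^sup>2))"
    using m \<open>\<mu> < 1\<close> by (intro mult_left_mono) auto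
  also have "\<dots> = M"
    unfolding \<open>M = _\<close> m_def[symmetric] by (simp add: mult_ac)
  finally show "norm x \<le> M * \<gamma> ^ (i - j - r)"
    using \<gamma> by (intro order_trans[OF bound] mult_right_mono) auto
qed

end
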